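(* Let $A$ be a Discoverer algorithm for the source detection game with consistent source behavior (with either known or unknown static graph) that watches $k$ nodes per round. Then there is a Discoverer algorithm $A^1$, watching one node per round, with the following property. Whenever $A$ tolerates at most $x$ successful infections in some instance of the game, $A^1$ tolerates at most $kx$ infections.
   Context: A temporal graph $\mathcal{G}=(V,E,\lambda)$ with lifetime $T_{\max}$ consists of a finite simple undirected graph $(V,E)$, called the underlying static graph, together with a labeling $\lambda\colon E\to\{1,\dots,T_{\max}\}$. The edge $e$ is present only at time $\lambda(e)$. Write $n=|V|$. Infections follow the SIR model with duration $\delta\ge1$. A node may be seed-infected at some time. A susceptible node $u$ becomes infected at time $t$ iff some neighbor $v$ is infectious at time $t$ and $\lambda(uv)=t$; exactly one such neighbor counts as its infector. The node $u$ is then infectious at times $t+1,\dots,t+\delta$ and resistant afterwards. SD game: an Adversary fixes the temporal graph, $T_{\max}$, $\delta$, and a source node $s$. The Discoverer is told $V$, $T_{\max}$, $\delta$, and, in the known-static-graph setting, also $E$ (never $\lambda$). In each round the Discoverer watches a set of nodes (up to $k$ of them in the $k$-watch variant). All nodes start susceptible, the source is seed-infected, and an infection chain unfolds. For each watched node, the Discoverer learns whether, when, and by which neighbor it was infected (or that it was the seed). Consistent source behavior means the same seed time and the same infection chain are used in every round. The Discoverer eventually names a node and wins iff it is $s$. The number of tolerated infections is the total number of nodes infected, summed over all rounds, until the Discoverer stops. *)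

theory Defs
  imports Main "HOL-Library.Extended_Nat"
begin

record 'v temporal_graph =
  nodes :: "'v set"
  edges :: "'v set set"
  label :: "'v set \<Rightarrow> nat"
  lifetime :: nat

definition temporal_graph :: "('v, 'b) temporal_graph_scheme \<Rightarrow> bool" where
  "temporal_graph G \<longleftrightarrow>
     finite (nodes G) \<and>
     (\<forall>e\<in>edges G. \<exists>u\<in>nodes G. \<exists>v\<in>nodes G. u \<noteq> v \<and> e = {u, v}) \<and>
     (\<forall>e\<in>edges G. label G e \<in> {1..lifetime G})"

text \<open>An infection chain assigns to every node its fate during one round. The last constructor
  carries the infector and the time of infection.\<close>

datatype 'v fate = Uninfected | Seeded nat | Infected_By 'v nat

definition infected_at :: "('v \<Rightarrow> 'v fate) \<Rightarrow> 'v \<Rightarrow> nat \<Rightarrow> bool" where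
  "infected_at c v t \<longleftrightarrow> c v = Seeded t \<or> (\<exists>u. c v = Infected_By u t)"

definition susceptible :: "('v \<Rightarrow> 'v fate) \<Rightarrow> 'v \<Rightarrow> nat \<Rightarrow> bool" where
  "susceptible c v t \<longleftrightarrow> (\<forall>t'<t. \<not> infected_at c v t')"

definition infectious :: "nat \<Rightarrow> ('v \<Rightarrow> 'v fate) \<Rightarrow> 'v \<Rightarrow> nat \<Rightarrow> bool" where
  "infectious \<delta> c v t \<longleftrightarrow> (\<exists>t'. infected_at c v t' \<and> t \<in> {t' + 1..t' + \<delta>})"

definition can_infect ::
    "('v, 'b) temporal_graph_scheme \<Rightarrow> nat \<Rightarrow> ('v \<Rightarrow> 'v fate) \<Rightarrow> 'v \<Rightarrow> 'v \<Rightarrow> nat \<Rightarrow> bool" where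
  "can_infect G \<delta> c v u t \<longleftrightarrow>
     {u, v} \<in> edges G \<and> label G {u, v} = t \<and> infectious \<delta> c v t"

text \<open>If several neighbours could infect a node at the same time, the chain may name any one of
  them as the infector; so a seed can have several infection chains.\<close>

definition infection_chain ::
    "('v, 'b) temporal_graph_scheme \<Rightarrow> nat \<Rightarrow> 'v \<Rightarrow> nat \<Rightarrow> ('v \<Rightarrow> 'v fate) \<Rightarrow> bool" where
  "infection_chain G \<delta> s t\<^sub>0 c \<longleftrightarrow>
     c s = Seeded t\<^sub>0 \<and>
     (\<forall>u\<in>nodes G - {s}.
        (\<forall>t. c u \<noteq> Seeded t) \<and>
        (\<forall>t. susceptible c u t \<longrightarrow> (infected_at c u t \<longleftrightarrow> (\<exists>v. can_infect G \<delta> c v u t))) \<and>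
        (\<forall>v t. c u = Infected_By v t \<longrightarrow> can_infect G \<delta> c v u t))"

text \<open>Everything chosen by the Adversary. Seed time and infection chain are indexed by the round
  (starting from 0).\<close>

record 'v sd_instance = "'v temporal_graph" +
  duration :: nat
  source :: 'v
  seed_time :: "nat \<Rightarrow> nat"
  chain :: "nat \<Rightarrow> 'v \<Rightarrow> 'v fate"

definition sd_instance :: "'v sd_instance \<Rightarrow> bool" where
  "sd_instance I \<longleftrightarrow>
     temporal_graph I \<and> duration I \<ge> 1 \<and> source I \<in> nodes I \<and>
     (\<forall>r. infection_chain I (duration I) (source I) (seed_time I r) (chain I r))"

definition consistent_source :: "'v sd_instance \<Rightarrow> bool" where
  "consistent_source I \<longleftrightarrow>
     (\<forall>r r'. seed_time I r = seed_time I r' \<and> (\<forall>u\<in>nodes I. chain I r u = chain I r' u))"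

datatype setting = Known_Static_Graph | Unknown_Static_Graph

text \<open>Node set, lifetime, infection duration and, if disclosed, the static edges.\<close>

type_synonym 'v briefing = "'v set \<times> nat \<times> nat \<times> 'v set set option"

fun briefing :: "setting \<Rightarrow> 'v sd_instance \<Rightarrow> 'v briefing" where
  "briefing Known_Static_Graph I = (nodes I, lifetime I, duration I, Some (edges I))"
| "briefing Unknown_Static_Graph I = (nodes I, lifetime I, duration I, None)"

text \<open>What the Discoverer sees in one round is a partial map whose domain is the set of watched
  nodes; a history lists the past rounds, oldest first.\<close>

type_synonym 'v history = "('v \<rightharpoonup> 'v fate) list"

datatype 'v move = Watch "'v set" | Name 'v

type_synonym 'v algorithm = "'v briefing \<Rightarrow> 'v history \<Rightarrow> 'v move"

definition observe :: "'v sd_instance \<Rightarrow> nat \<Rightarrow> 'v set \<Rightarrow> ('v \<rightharpoonup> 'v fate)" where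
  "observe I r W = (\<lambda>u. if u \<in> W then Some (chain I r u) else None)"

text \<open>The history before round \<open>r\<close>; it stays constant once the Discoverer has named a node.\<close>

primrec history :: "setting \<Rightarrow> 'v algorithm \<Rightarrow> 'v sd_instance \<Rightarrow> nat \<Rightarrow> 'v history" where
  "history st A I 0 = []"
| "history st A I (Suc r) =
     (case A (briefing st I) (history st A I r) of
        Watch W \<Rightarrow> history st A I r @ [observe I r W]
      | Name v \<Rightarrow> history st A I r)"

definition move_in_round :: "setting \<Rightarrow> 'v algorithm \<Rightarrow> 'v sd_instance \<Rightarrow> nat \<Rightarrow> 'v move" where
  "move_in_round st A I r = A (briefing st I) (history st A I r)"

definition wins :: "setting \<Rightarrow> 'v algorithm \<Rightarrow> 'v sd_instance \<Rightarrow> bool" where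
  "wins st A I \<longleftrightarrow> (\<exists>r. move_in_round st A I r = Name (source I))"

definition infections_in_round :: "setting \<Rightarrow> 'v algorithm \<Rightarrow> 'v sd_instance \<Rightarrow> nat \<Rightarrow> nat" where
  "infections_in_round st A I r =
     (case move_in_round st A I r of
        Watch W \<Rightarrow> card {u \<in> nodes I. chain I r u \<noteq> Uninfected}
      | Name v \<Rightarrow> 0)"

text \<open>The value is infinite iff the Discoverer never stops, since every round infects at least
  the source.\<close>

definition tolerated_infections :: "setting \<Rightarrow> 'v algorithm \<Rightarrow> 'v sd_instance \<Rightarrow> enat" where
  "tolerated_infections st A I = (SUP n. enat (\<Sum>r<n. infections_in_round st A I r))"

text \<open>A Discoverer algorithm for the game with consistent source behavior in which up to \<open>k\<close> nodes
  may be watched per round. Only moves that can occur in a play are constrained.\<close>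

definition consistent_k_watch_algorithm :: "setting \<Rightarrow> nat \<Rightarrow> 'v algorithm \<Rightarrow> bool" where
  "consistent_k_watch_algorithm st k A \<longleftrightarrow>
     (\<forall>I r W. sd_instance I \<and> consistent_source I \<and> move_in_round st A I r = Watch W \<longrightarrow>
        W \<subseteq> nodes I \<and> card W \<le> k)"

end

theory Submission
  imports Defs
begin

text \<open>Under consistent source behavior a node needs to be watched only once, since its fate is the
  same in every round. So \<open>A1\<close> keeps all fates seen so far, replays \<open>A\<close> on them as far as they
  reach, and spends a round only on a node whose fate \<open>A\<close> asks for and which is still unknown. If
  \<open>A\<close> stops after \<open>R\<close> rounds, it has watched at most \<open>k * R\<close> distinct nodes, so \<open>A1\<close> stops after at
  most \<open>k * R\<close> rounds; and all rounds cause the same number of infections.\<close>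

definition knowledge :: "'v history \<Rightarrow> ('v \<rightharpoonup> 'v fate)" where
  "knowledge h = foldl (++) Map.empty h"

lemma knowledge_Nil [simp]: "knowledge [] = Map.empty"
  by (simp add: knowledge_def)

lemma knowledge_snoc [simp]: "knowledge (h @ [f]) = knowledge h ++ f"
  by (simp add: knowledge_def)

text \<open>The replay gets stuck as soon as \<open>A\<close> watches a node outside the domain of \<open>K\<close>.\<close>

primrec replay :: "'v algorithm \<Rightarrow> 'v briefing \<Rightarrow> ('v \<rightharpoonup> 'v fate) \<Rightarrow> nat \<Rightarrow> 'v history" where
  "replay A b K 0 = []"
| "replay A b K (Suc r) =
     (case A b (replay A b K r) of
        Watch W \<Rightarrow> if W \<subseteq> dom K then replay A b K r @ [K |` W] else replay A b K r
      | Name v \<Rightarrow> replay A b K r)"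

definition verdict :: "'v algorithm \<Rightarrow> 'v briefing \<Rightarrow> ('v \<rightharpoonup> 'v fate) \<Rightarrow> 'v \<Rightarrow> bool" where
  "verdict A b K v \<longleftrightarrow> (\<exists>r. A b (replay A b K r) = Name v)"

definition missing :: "'v algorithm \<Rightarrow> 'v briefing \<Rightarrow> ('v \<rightharpoonup> 'v fate) \<Rightarrow> 'v \<Rightarrow> bool" where
  "missing A b K u \<longleftrightarrow> u \<notin> dom K \<and> (\<exists>r W. A b (replay A b K r) = Watch W \<and> u \<in> W)"

text \<open>The last case only arises if the replay of \<open>A\<close> runs forever.\<close>

definition one_watch :: "'v algorithm \<Rightarrow> 'v algorithm" where
  "one_watch A b h =
     (let K = knowledge h in
      if \<exists>v. verdict A b K v then Name (SOME v. verdict A b K v)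
      else if \<exists>u. missing A b K u then Watch {SOME u. missing A b K u}
      else Watch {})"

lemma one_watch_cases:
  obtains v where "one_watch A b h = Name v" "verdict A b (knowledge h) v"
  | u where "one_watch A b h = Watch {u}" "missing A b (knowledge h) u"
  | "one_watch A b h = Watch {}" "\<nexists>v. verdict A b (knowledge h) v"
      "\<nexists>u. missing A b (knowledge h) u"
proof (cases "\<exists>v. verdict A b (knowledge h) v")
  case True
  then have "verdict A b (knowledge h) (SOME v. verdict A b (knowledge h) v)"
    by (rule someI_ex)
  with True show thesis by (intro that(1)) (simp_all add: one_watch_def Let_def)
next
  case no_verdict: False
  show thesis
  proof (cases "\<exists>u. missing A b (knowledge h) u")
    case True
    then have "missing A b (knowledge h) (SOME u. missing A b (knowledge h) u)"
      by (rule someI_ex)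
    with True no_verdict show thesis by (intro that(2)) (simp_all add: one_watch_def Let_def)
  next
    case False
    with no_verdict that(3) show thesis by (simp add: one_watch_def)
  qed
qed

lemma dom_observe [simp]: "dom (observe I r W) = W"
  by (auto simp: observe_def split: if_splits)

lemma history_Suc:
  "history st A I (Suc r) =
     (case move_in_round st A I r of
        Watch W \<Rightarrow> history st A I r @ [observe I r W]
      | Name v \<Rightarrow> history st A I r)"
  by (simp add: move_in_round_def)

lemma move_in_round_after_Name:
  assumes "move_in_round st A I r = Name v" and "r \<le> r'"
  shows "move_in_round st A I r' = Name v"
  using assms(2)
proof (induction r' rule: dec_induct)
  case base
  show ?case by (fact assms(1))
next
  case (step n)
  then have "history st A I (Suc n) = history st A I n"
    by (simp add: history_Suc del: history.simps)
  with step.IH show ?case by (simp add: move_in_round_def)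
qed

lemma move_in_round_Name_unique:
  assumes "move_in_round st A I r = Name v" and "move_in_round st A I r' = Name v'"
  shows "v = v'"
  using move_in_round_after_Name[OF assms(1), of "max r r'"]
    move_in_round_after_Name[OF assms(2), of "max r r'"] by simp

locale consistent_instance =
  fixes I :: "'v sd_instance"
  assumes sd_instance: "sd_instance I"
    and consistent_source: "consistent_source I"
begin

lemma finite_nodes: "finite (nodes I)"
  using sd_instance by (simp add: sd_instance_def temporal_graph_def)

lemma chain_eq: "u \<in> nodes I \<Longrightarrow> chain I r u = chain I r' u"
  using consistent_source unfolding consistent_source_def by blast

definition infections_per_round :: nat where
  "infections_per_round = card {u \<in> nodes I. chain I 0 u \<noteq> Uninfected}"

lemma infections_per_round_pos: "infections_per_round > 0"
proof -
  have "source I \<in> nodes I" "chain I 0 (source I) = Seeded (seed_time I 0)"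
    using sd_instance by (auto simp: sd_instance_def infection_chain_def)
  then have "source I \<in> {u \<in> nodes I. chain I 0 u \<noteq> Uninfected}" by simp
  then show ?thesis
    using finite_nodes by (auto simp: infections_per_round_def card_gt_0_iff)
qed

lemma infections_in_round_eq:
  "infections_in_round st A I r =
     (case move_in_round st A I r of Watch W \<Rightarrow> infections_per_round | Name v \<Rightarrow> 0)"
proof -
  have "{u \<in> nodes I. chain I r u \<noteq> Uninfected} = {u \<in> nodes I. chain I 0 u \<noteq> Uninfected}"
    using chain_eq by (metis (lifting))
  then show ?thesis
    by (simp add: infections_in_round_def infections_per_round_def split: move.split)
qed

lemma tolerated_infections_stop:
  assumes stop: "move_in_round st A I R = Name v"
    and before: "\<And>r w. r < R \<Longrightarrow> move_in_round st A I r \<noteq> Name w"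
  shows "tolerated_infections st A I = enat (R * infections_per_round)"
proof -
  have infections: "infections_in_round st A I r = (if r < R then infections_per_round else 0)" for r
    using before[of r] move_in_round_after_Name[OF stop, of r]
    by (auto simp: infections_in_round_eq split: move.split)
  have sum: "(\<Sum>r<n. infections_in_round st A I r) = min n R * infections_per_round" for n
    unfolding infections by (induction n) (auto simp: min_def)
  show ?thesis
    unfolding tolerated_infections_def sum
  proof (rule antisym)
    show "(SUP n. enat (min n R * infections_per_round)) \<le> enat (R * infections_per_round)"
      by (rule SUP_least) simp
    show "enat (R * infections_per_round) \<le> (SUP n. enat (min n R * infections_per_round))"
      by (rule SUP_upper2[of R]) simp_all
  qed
qed

lemma stops_if_tolerated_infections_finite:
  assumes "tolerated_infections st A I \<le> enat x"
  shows "\<exists>r v. move_in_round st A I r = Name v"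
proof (rule ccontr)
  assume "\<not> ?thesis"
  then have "infections_in_round st A I r = infections_per_round" for r
    by (auto simp: infections_in_round_eq split: move.split)
  then have "enat (Suc x * infections_per_round) = enat (\<Sum>r<Suc x. infections_in_round st A I r)"
    by simp
  also have "\<dots> \<le> tolerated_infections st A I"
    unfolding tolerated_infections_def by (rule SUP_upper) simp
  also have "\<dots> \<le> enat x" by (fact assms)
  finally have "Suc x * infections_per_round \<le> x" by simp
  moreover have "Suc x * 1 \<le> Suc x * infections_per_round"
    using infections_per_round_pos by (intro mult_le_mono2) simp
  ultimately show False by simp
qed

lemma restrict_eq_observe:
  assumes "K \<subseteq>\<^sub>m observe I 0 (nodes I)" and "W \<subseteq> dom K"
  shows "K |` W = observe I r W"
proof
  fix u
  show "(K |` W) u = observe I r W u"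
  proof (cases "u \<in> W")
    case True
    then have u: "u \<in> dom K" using assms(2) by blast
    with assms(1) have "K u = observe I 0 (nodes I) u" by (auto simp: map_le_def)
    moreover have "u \<in> nodes I" using map_le_implies_dom_le[OF assms(1)] u by auto
    ultimately show ?thesis using True chain_eq[of u 0 r] by (simp add: observe_def)
  qed (simp add: observe_def)
qed

lemma replay_in_play:
  assumes K: "K \<subseteq>\<^sub>m observe I 0 (nodes I)"
  shows "\<exists>j. replay A (briefing st I) K r = history st A I j"
proof (induction r)
  case 0
  show ?case by (rule exI[of _ 0]) simp
next
  case (Suc r)
  then obtain j where j: "replay A (briefing st I) K r = history st A I j" ..
  show ?case
  proof (cases "A (briefing st I) (history st A I j)")
    case (Name v)
    then show ?thesis using j by auto
  next
    case (Watch W)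
    show ?thesis
    proof (cases "W \<subseteq> dom K")
      case True
      then have "replay A (briefing st I) K (Suc r) = history st A I (Suc j)"
        using j Watch restrict_eq_observe[OF K True, of j] by simp
      then show ?thesis ..
    qed (use j Watch in auto)
  qed
qed

lemma replay_complete:
  assumes K: "K \<subseteq>\<^sub>m observe I 0 (nodes I)"
    and none: "\<nexists>u. missing A (briefing st I) K u"
  shows "replay A (briefing st I) K r = history st A I r"
proof (induction r)
  case (Suc r)
  show ?case
  proof (cases "A (briefing st I) (history st A I r)")
    case (Watch W)
    with Suc none have "W \<subseteq> dom K"
      unfolding missing_def by (metis subsetI)
    then show ?thesis using Suc Watch restrict_eq_observe[OF K, of W r] by simp
  qed (use Suc in simp)
qed simp

lemma verdict_in_play:
  assumes "K \<subseteq>\<^sub>m observe I 0 (nodes I)" and "verdict A (briefing st I) K v"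
  shows "\<exists>j. move_in_round st A I j = Name v"
  using assms(2) replay_in_play[OF assms(1), where A = A and st = st]
  unfolding verdict_def move_in_round_def by metis

lemma missing_in_play:
  assumes "K \<subseteq>\<^sub>m observe I 0 (nodes I)" and "missing A (briefing st I) K u"
  shows "\<exists>j W. move_in_round st A I j = Watch W \<and> u \<in> W"
  using assms(2) replay_in_play[OF assms(1), where A = A and st = st]
  unfolding missing_def move_in_round_def by metis

context
  fixes st :: setting and k :: nat and A :: "'v algorithm"
  assumes k_watch: "consistent_k_watch_algorithm st k A"
begin

lemma watched:
  assumes "move_in_round st A I r = Watch W"
  shows "W \<subseteq> nodes I" and "card W \<le> k"
  using k_watch assms sd_instance consistent_source
  unfolding consistent_k_watch_algorithm_def by blast+

lemma one_watch_Watch: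
  assumes K: "knowledge (history st (one_watch A) I r) \<subseteq>\<^sub>m observe I 0 (nodes I)"
    and "move_in_round st (one_watch A) I r = Watch W"
  shows "W \<subseteq> nodes I \<and> card W \<le> 1"
proof (cases rule: one_watch_cases[of A "briefing st I" "history st (one_watch A) I r"])
  case (1 v)
  then show ?thesis using assms(2) by (simp add: move_in_round_def)
next
  case (2 u)
  then have "u \<in> nodes I" using missing_in_play[OF K] watched(1) by blast
  then show ?thesis using 2 assms(2) by (auto simp: move_in_round_def)
next
  case 3
  then show ?thesis using assms(2) by (simp add: move_in_round_def)
qed

lemma knowledge_le:
  "knowledge (history st (one_watch A) I r) \<subseteq>\<^sub>m observe I 0 (nodes I)"
proof (induction r)
  case (Suc r)
  show ?case
  proof (cases "move_in_round st (one_watch A) I r")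
    case (Watch W)
    then have "W \<subseteq> nodes I" using one_watch_Watch[OF Suc] by blast
    then have "observe I r W \<subseteq>\<^sub>m observe I 0 (nodes I)"
      using chain_eq[of _ r 0] by (auto simp: map_le_def observe_def)
    then show ?thesis using Suc Watch
      by (simp add: history_Suc map_add_le_mapI del: history.simps)
  qed (use Suc in \<open>simp add: history_Suc del: history.simps\<close>)
qed simp

lemma one_watch_Name:
  assumes "move_in_round st (one_watch A) I r = Name v"
  shows "\<exists>j. move_in_round st A I j = Name v"
  using assms verdict_in_play[OF knowledge_le]
  by (cases rule: one_watch_cases[of A "briefing st I" "history st (one_watch A) I r"])
    (auto simp: move_in_round_def)

lemma one_watch_stops:
  assumes stop: "move_in_round st A I R = Name v"
  shows "\<exists>n \<le> k * R. move_in_round st (one_watch A) I n = Name v"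
proof -
  define U where "U = (\<Union>j<R. case move_in_round st A I j of Watch W \<Rightarrow> W | Name v \<Rightarrow> {})"
  have finite_U: "finite U"
    unfolding U_def using watched(1) finite_subset[OF _ finite_nodes]
    by (auto split: move.split)
  have "card U \<le> (\<Sum>j<R. card (case move_in_round st A I j of Watch W \<Rightarrow> W | Name v \<Rightarrow> {}))"
    unfolding U_def by (rule card_UN_le) simp
  also have "\<dots> \<le> (\<Sum>j<R. k)"
    by (rule sum_mono) (auto split: move.split dest: watched(2))
  finally have card_U: "card U \<le> k * R" by (simp add: mult.commute)
  define D where "D n = dom (knowledge (history st (one_watch A) I n))" for n
  have progress: "D n \<subseteq> U \<and> card (D n) = n"
    if "\<And>i w. i < n \<Longrightarrow> move_in_round st (one_watch A) I i \<noteq> Name w" for n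
    using that
  proof (induction n)
    case 0
    show ?case by (simp add: D_def)
  next
    case (Suc n)
    then have IH: "D n \<subseteq> U" "card (D n) = n" by simp_all
    show ?case
    proof (cases rule: one_watch_cases[of A "briefing st I" "history st (one_watch A) I n"])
      case (1 w)
      then show ?thesis using Suc.prems[of n w] by (simp add: move_in_round_def)
    next
      case (2 u)
      then obtain j W where j: "move_in_round st A I j = Watch W" "u \<in> W"
        using missing_in_play[OF knowledge_le] by blast
      then have "j < R" using move_in_round_after_Name[OF stop, of j] by (cases "j < R") auto
      with j have "u \<in> U" unfolding U_def by force
      moreover have "u \<notin> D n" using 2(2) by (simp add: missing_def D_def)
      moreover have "D (Suc n) = insert u (D n)" using 2(1) by (simp add: D_def)
      moreover have "finite (D n)" using IH(1) finite_U finite_subset by blast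
      ultimately show ?thesis using IH by simp
    next
      case 3
      then have "replay A (briefing st I) (knowledge (history st (one_watch A) I n)) R
          = history st A I R"
        using replay_complete[OF knowledge_le] by blast
      then show ?thesis using 3(2) stop unfolding verdict_def move_in_round_def by metis
    qed
  qed
  have "\<exists>i < Suc (card U). \<exists>w. move_in_round st (one_watch A) I i = Name w"
  proof (rule ccontr)
    assume "\<not> ?thesis"
    then have "D (Suc (card U)) \<subseteq> U" "card (D (Suc (card U))) = Suc (card U)"
      using progress by blast+
    then show False using card_mono[OF finite_U, of "D (Suc (card U))"] by simp
  qed
  then obtain i w where i: "i \<le> card U" "move_in_round st (one_watch A) I i = Name w"
    by (auto simp: less_Suc_eq_le)
  with one_watch_Name stop have "w = v" using move_in_round_Name_unique by metis
  with i card_U show ?thesis using le_trans by blast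
qed

lemma one_watch_wins: "wins st A I \<Longrightarrow> wins st (one_watch A) I"
  unfolding wins_def using one_watch_stops by blast

lemma one_watch_tolerated_infections:
  assumes "tolerated_infections st A I \<le> enat x"
  shows "tolerated_infections st (one_watch A) I \<le> enat (k * x)"
proof -
  define R where "R = (LEAST r. \<exists>v. move_in_round st A I r = Name v)"
  have "\<exists>v. move_in_round st A I R = Name v"
    unfolding R_def by (rule LeastI_ex) (rule stops_if_tolerated_infections_finite[OF assms])
  then obtain v where v: "move_in_round st A I R = Name v" ..
  have "tolerated_infections st A I = enat (R * infections_per_round)"
    using v by (rule tolerated_infections_stop) (auto simp: R_def dest: not_less_Least)
  with assms have R: "R * infections_per_round \<le> x" by simp
  define N where "N = (LEAST n. \<exists>v. move_in_round st (one_watch A) I n = Name v)"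
  obtain n where n: "n \<le> k * R" "move_in_round st (one_watch A) I n = Name v"
    using one_watch_stops[OF v] by blast
  have "\<exists>w. move_in_round st (one_watch A) I N = Name w"
    unfolding N_def by (rule LeastI_ex) (use n in blast)
  then obtain w where w: "move_in_round st (one_watch A) I N = Name w" ..
  have "N \<le> n" unfolding N_def by (rule Least_le) (use n in blast)
  have "tolerated_infections st (one_watch A) I = enat (N * infections_per_round)"
    using w by (rule tolerated_infections_stop) (auto simp: N_def dest: not_less_Least)
  also have "N * infections_per_round \<le> k * R * infections_per_round"
    using \<open>N \<le> n\<close> n(1) by (intro mult_le_mono1) simp
  also have "\<dots> \<le> k * x" using R by (simp add: mult.assoc)
  finally show ?thesis by simp
qed

end

end

theorem theorem9:
  fixes st :: setting and k :: nat and A :: "'v algorithm"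
  assumes "consistent_k_watch_algorithm st k A"
  shows "\<exists>A1 :: 'v algorithm.
    consistent_k_watch_algorithm st 1 A1 \<and>
    (\<forall>I. sd_instance I \<and> consistent_source I \<longrightarrow>
       (wins st A I \<longrightarrow> wins st A1 I) \<and>
       (\<forall>x::nat. tolerated_infections st A I \<le> enat x \<longrightarrow>
          tolerated_infections st A1 I \<le> enat (k * x)))"
proof (intro exI[of _ "one_watch A"] conjI allI impI)
  show "consistent_k_watch_algorithm st 1 (one_watch A)"
    unfolding consistent_k_watch_algorithm_def
  proof (intro allI impI)
    fix I :: "'v sd_instance" and r W
    assume asm: "sd_instance I \<and> consistent_source I \<and>
      move_in_round st (one_watch A) I r = Watch W"
    then interpret consistent_instance I by unfold_locales auto
    show "W \<subseteq> nodes I \<and> card W \<le> 1"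
      using one_watch_Watch[OF assms knowledge_le[OF assms]] asm by blast
  qed
next
  fix I :: "'v sd_instance"
  assume "sd_instance I \<and> consistent_source I"
  then interpret consistent_instance I by unfold_locales auto
  show "wins st (one_watch A) I" if "wins st A I"
    using one_watch_wins[OF assms that] .
  show "tolerated_infections st (one_watch A) I \<le> enat (k * x)"
    if "tolerated_infections st A I \<le> enat x" for x
    using one_watch_tolerated_infections[OF assms that] .
qed

end
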